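(* Suppose $f\colon \mathbb{N} \to [0,\infty)$ is a sub-identical order function such that $\sum_{m=0}^\infty f(2^m)/2^m$ converges. Then for every rational $\delta \in (0,1]$, $\mathrm{SC}(f) \leq_{\mathrm{s}} \mathrm{COMPLEX}(\delta)$.
   Context: An order function is a computable (i.e. its values are uniformly computable reals), nondecreasing, unbounded function $\mathbb{N}\to\mathbb{R}$. A function $f\colon\mathbb{N}\to[0,\infty)$ is sub-identical if $\lim_{n\to\infty}(n-f(n))=\infty$. Prefix-free complexity: a prefix-free machine is a partial recursive $M$ from $\{0,1\}^*$ to $\{0,1\}^*$ with prefix-free domain; $U$ is universal if for each prefix-free machine $M$ there is $\rho$ with $U(\rho^\frown\tau)\simeq M(\tau)$ for all $\tau$. Fix a universal $U$ and let $K(\sigma)=\min\{|\tau| : U(\tau)=\sigma\}$. For $\delta\in(0,1]$, $\mathrm{COMPLEX}(\delta)$ is the set of $X\in\{0,1\}^{\mathbb{N}}$ for which there is $c\in\mathbb{N}$ with $K(X\upharpoonright n)\geq \delta n-c$ for all $n$. $\mathrm{SC}(f)$ is the set of $X\in\{0,1\}^{\mathbb{N}}$ for which there is $c\in\mathbb{N}$ with $K(\tau)\geq f(|\tau|)-c$ for every (contiguous, finite) substring $\tau$ of $X$. For $P,Q\subseteq\mathbb{N}^{\mathbb{N}}$, $P\leq_{\mathrm{s}}Q$ means there is a partial recursive functional defined on all of $Q$ that maps $Q$ into $P$. *)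

theory Defs
  imports Complex_Main "HOL-Library.Sublist"
begin

section \<open>Partial recursive functions with an oracle\<close>

datatype recf =
    Zero
  | Succ
  | Proj nat
  | Oracle
  | Comp recf "recf list"
  | PrimRec recf recf
  | Mu recf

text \<open>\<open>run p A xs\<close> is the value of the \<open>\<mu>\<close>-recursive program \<open>p\<close> with oracle \<open>A\<close> on the arguments
  \<open>xs\<close>; it is \<^term>\<open>None\<close> if the computation diverges or the number of arguments does not fit.
  Primitive recursion is on the first argument, and the argument bound by \<open>Mu\<close> comes first.\<close>

fun run :: "recf \<Rightarrow> (nat \<Rightarrow> nat) \<Rightarrow> nat list \<Rightarrow> nat option" where
  "run Zero A xs = Some 0"
| "run Succ A xs = (if length xs = 1 then Some (Suc (xs ! 0)) else None)"
| "run (Proj i) A xs = (if i < length xs then Some (xs ! i) else None)"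
| "run Oracle A xs = (if length xs = 1 then Some (A (xs ! 0)) else None)"
| "run (Comp p qs) A xs = Option.bind (those (map (\<lambda>q. run q A xs) qs)) (\<lambda>ys. run p A ys)"
| "run (PrimRec p q) A xs =
     (case xs of
        [] \<Rightarrow> None
      | n # ys \<Rightarrow> rec_nat (run p A ys) (\<lambda>k r. Option.bind r (\<lambda>v. run q A (k # v # ys))) n)"
| "run (Mu p) A xs =
     (let least_zero = (\<lambda>n. run p A (n # xs) = Some 0 \<and>
                            (\<forall>m<n. \<exists>v. run p A (m # xs) = Some (Suc v)))
      in if \<exists>n. least_zero n then Some (LEAST n. least_zero n) else None)"

fun oracle_free :: "recf \<Rightarrow> bool" where
  "oracle_free Oracle = False"
| "oracle_free (Comp p qs) = (oracle_free p \<and> (\<forall>q\<in>set qs. oracle_free q))"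
| "oracle_free (PrimRec p q) = (oracle_free p \<and> oracle_free q)"
| "oracle_free (Mu p) = oracle_free p"
| "oracle_free _ = True"

lemma run_oracle_free:
  assumes "oracle_free p"
  shows "run p A xs = run p B xs"
  using assms
proof (induction p arbitrary: xs)
  case (Comp p qs)
  have "map (\<lambda>q. run q A xs) qs = map (\<lambda>q. run q B xs) qs"
    using Comp by auto
  moreover have "run p A = run p B"
    using Comp by auto
  ultimately show ?case by (simp only: run.simps)
next
  case (PrimRec p q)
  then have "run p A = run p B" "run q A = run q B" by auto
  then show ?case by (simp only: run.simps)
next
  case (Mu p)
  then have "run p A = run p B" by auto
  then show ?case by (simp only: run.simps)
qed auto

definition partial_recursive :: "nat \<Rightarrow> (nat list \<Rightarrow> nat option) \<Rightarrow> bool" where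
  "partial_recursive k F \<longleftrightarrow>
     (\<exists>p. oracle_free p \<and> (\<forall>xs. length xs = k \<longrightarrow> run p (\<lambda>_. 0) xs = F xs))"

definition total_recursive2 :: "(nat \<Rightarrow> nat \<Rightarrow> nat) \<Rightarrow> bool" where
  "total_recursive2 g \<longleftrightarrow> partial_recursive 2 (\<lambda>xs. Some (g (xs ! 0) (xs ! 1)))"

section \<open>Partial recursive functionals and strong reducibility\<close>

text \<open>A functional is applied to an element of Baire space; it is undefined at \<open>X\<close> unless the output
  sequence is total.\<close>

definition functional_of :: "recf \<Rightarrow> (nat \<Rightarrow> nat) \<Rightarrow> (nat \<Rightarrow> nat) option" where
  "functional_of p X =
     (if \<forall>n. run p X [n] \<noteq> None then Some (\<lambda>n. the (run p X [n])) else None)"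

definition partial_recursive_functional :: "((nat \<Rightarrow> nat) \<Rightarrow> (nat \<Rightarrow> nat) option) \<Rightarrow> bool" where
  "partial_recursive_functional \<Psi> \<longleftrightarrow> (\<exists>p. \<Psi> = functional_of p)"

definition strongly_reducible :: "(nat \<Rightarrow> nat) set \<Rightarrow> (nat \<Rightarrow> nat) set \<Rightarrow> bool"
    (infix "\<le>\<^sub>s" 50) where
  "P \<le>\<^sub>s Q \<longleftrightarrow>
     (\<exists>\<Psi>. partial_recursive_functional \<Psi> \<and> (\<forall>X\<in>Q. \<exists>Y\<in>P. \<Psi> X = Some Y))"

text \<open>Cantor space \<^typ>\<open>nat \<Rightarrow> bool\<close> is viewed as the set of 0-1-valued elements of Baire space.\<close>

definition in_baire :: "(nat \<Rightarrow> bool) set \<Rightarrow> (nat \<Rightarrow> nat) set" where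
  "in_baire P = (\<lambda>X n. of_bool (X n)) ` P"

section \<open>Prefix-free complexity\<close>

text \<open>Bijective base-2 numeration, least significant digit first.\<close>

primrec str_code :: "bool list \<Rightarrow> nat" where
  "str_code [] = 0"
| "str_code (b # \<sigma>) = 2 * str_code \<sigma> + (if b then 2 else 1)"

lemma bij_str_code: "bij str_code"
proof (rule bijI)
  show "inj str_code"
  proof (rule injI)
    fix \<sigma> \<tau> show "str_code \<sigma> = str_code \<tau> \<Longrightarrow> \<sigma> = \<tau>"
    proof (induction \<sigma> arbitrary: \<tau>)
      case Nil
      then show ?case by (cases \<tau>) (auto split: if_splits)
    next
      case (Cons b \<sigma>)
      then obtain c \<rho> where \<tau>: "\<tau> = c # \<rho>" by (cases \<tau>) (auto split: if_splits)
      have "2 * str_code \<sigma> + (if b then 2 else 1) = 2 * str_code \<rho> + (if c then 2 else 1)"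
        using Cons.prems \<tau> by simp
      then have "b = c \<and> str_code \<sigma> = str_code \<rho>"
        by (cases b; cases c) (simp_all, presburger+)
      then show ?case using Cons.IH \<tau> by blast
    qed
  qed
  have "\<exists>\<sigma>. n = str_code \<sigma>" for n
  proof (induction n rule: less_induct)
    case (less n)
    have "n = 0 \<or> n = 2 * ((n - 1) div 2) + 1 \<or> n = 2 * ((n - 1) div 2) + 2"
      by arith
    then consider "n = 0" | m where "n = 2 * m + 1" | m where "n = 2 * m + 2"
      by blast
    then show ?case
    proof cases
      case 1 then show ?thesis by (intro exI[of _ "[]"]) simp
    next
      case (2 m)
      then obtain \<sigma> where "m = str_code \<sigma>" using less by fastforce
      then show ?thesis using 2 by (intro exI[of _ "False # \<sigma>"]) simp
    next
      case (3 m)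
      then obtain \<sigma> where "m = str_code \<sigma>" using less by fastforce
      then show ?thesis using 3 by (intro exI[of _ "True # \<sigma>"]) simp
    qed
  qed
  then show "surj str_code" unfolding surj_def by blast
qed

definition prefix_free_machine :: "(bool list \<Rightarrow> bool list option) \<Rightarrow> bool" where
  "prefix_free_machine M \<longleftrightarrow>
     (\<exists>F. partial_recursive 1 F \<and> (\<forall>\<sigma>. F [str_code \<sigma>] = map_option str_code (M \<sigma>))) \<and>
     (\<forall>\<sigma>\<in>dom M. \<forall>\<tau>\<in>dom M. prefix \<sigma> \<tau> \<longrightarrow> \<sigma> = \<tau>)"

definition universal_machine :: "(bool list \<Rightarrow> bool list option) \<Rightarrow> bool" where
  "universal_machine U \<longleftrightarrow>
     prefix_free_machine U \<and>
     (\<forall>M. prefix_free_machine M \<longrightarrow> (\<exists>\<rho>. \<forall>\<tau>. U (\<rho> @ \<tau>) = M \<tau>))"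

text \<open>The minimum is over a nonempty set when \<open>U\<close> is universal.\<close>

definition K :: "(bool list \<Rightarrow> bool list option) \<Rightarrow> bool list \<Rightarrow> nat" where
  "K U \<sigma> = (LEAST n. \<exists>\<tau>. length \<tau> = n \<and> U \<tau> = Some \<sigma>)"

definition COMPLEX :: "(bool list \<Rightarrow> bool list option) \<Rightarrow> real \<Rightarrow> (nat \<Rightarrow> bool) set" where
  "COMPLEX U \<delta> = {X. \<exists>c::nat. \<forall>n. real (K U (map X [0..<n])) \<ge> \<delta> * real n - real c}"

definition substring_of :: "bool list \<Rightarrow> (nat \<Rightarrow> bool) \<Rightarrow> bool" where
  "substring_of \<tau> X \<longleftrightarrow> (\<exists>i j. \<tau> = map X [i..<j])"

definition SC :: "(bool list \<Rightarrow> bool list option) \<Rightarrow> (nat \<Rightarrow> real) \<Rightarrow> (nat \<Rightarrow> bool) set" where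
  "SC U f = {X. \<exists>c::nat. \<forall>\<tau>. substring_of \<tau> X \<longrightarrow> real (K U \<tau>) \<ge> f (length \<tau>) - real c}"

section \<open>Order functions\<close>

text \<open>Uniformly computable reals: the rationals \<open>(-1)^s p/q\<close>, computed from \<open>n\<close> and \<open>k\<close>,
  approximate \<open>f n\<close> to within \<open>2^(-k)\<close>.\<close>

definition computable_real_function :: "(nat \<Rightarrow> real) \<Rightarrow> bool" where
  "computable_real_function f \<longleftrightarrow>
     (\<exists>s p q. total_recursive2 s \<and> total_recursive2 p \<and> total_recursive2 q \<and>
        (\<forall>n k. q n k \<noteq> 0 \<and>
           \<bar>f n - (- 1) ^ s n k * real (p n k) / real (q n k)\<bar> \<le> 1 / 2 ^ k))"

definition order_function :: "(nat \<Rightarrow> real) \<Rightarrow> bool" where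
  "order_function f \<longleftrightarrow>
     computable_real_function f \<and> mono f \<and> \<not> bdd_above (range f)"

definition sub_identical :: "(nat \<Rightarrow> real) \<Rightarrow> bool" where
  "sub_identical f \<longleftrightarrow>
     (\<forall>n. 0 \<le> f n) \<and> filterlim (\<lambda>n. real n - f n) at_top sequentially"

end

theory Submission
  imports Defs
begin

text \<open>The functional is \<open>X \<mapsto> X \<circ> h\<close> for a recursive Toeplitz map \<open>h\<close>: with density about \<open>g(m)/2\<^sup>m\<close>,
  positions are reserved for a level \<open>m \<ge> m0\<close>, so that every aligned block of length \<open>2\<^sup>m\<close> contains a
  copy of the first \<open>g(m)\<close> bits of \<open>X\<close>, where \<open>\<delta> g(m) \<ge> f(2\<^bsup>m+3\<^esup>) + 2m\<close>. The densities are summable, so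
  there is room for all levels if \<open>m0\<close> is large. A substring \<open>\<tau>\<close> of length between \<open>2\<^bsup>m+2\<^esup>\<close> and
  \<open>2\<^bsup>m+3\<^esup>\<close> contains such a block, and the offset of the block is described with \<open>2m + O(1)\<close> bits; hence
  \<open>\<delta> g(m) - O(1) \<le> K(X \<restriction> g(m)) \<le> K(\<tau>) + 2m + O(1)\<close>, that is, \<open>K(\<tau>) \<ge> f(|\<tau>|) - O(1)\<close>.\<close>

section \<open>Total recursive functions\<close>

text \<open>The value must come out under every oracle, so that one program serves in machines, run
  with the zero oracle, and in functionals, run with oracle \<open>X\<close>.\<close>

definition total_rec :: "nat \<Rightarrow> (nat list \<Rightarrow> nat) \<Rightarrow> bool" where
  "total_rec k \<phi> \<longleftrightarrow>
     (\<exists>p. oracle_free p \<and> (\<forall>A xs. length xs = k \<longrightarrow> run p A xs = Some (\<phi> xs)))"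

abbreviation rec1 :: "(nat \<Rightarrow> nat) \<Rightarrow> bool" where
  "rec1 f \<equiv> total_rec 1 (\<lambda>xs. f (xs ! 0))"

abbreviation rec2 :: "(nat \<Rightarrow> nat \<Rightarrow> nat) \<Rightarrow> bool" where
  "rec2 f \<equiv> total_rec 2 (\<lambda>xs. f (xs ! 0) (xs ! 1))"

abbreviation rec3 :: "(nat \<Rightarrow> nat \<Rightarrow> nat \<Rightarrow> nat) \<Rightarrow> bool" where
  "rec3 f \<equiv> total_rec 3 (\<lambda>xs. f (xs ! 0) (xs ! 1) (xs ! 2))"

abbreviation rec4 :: "(nat \<Rightarrow> nat \<Rightarrow> nat \<Rightarrow> nat \<Rightarrow> nat) \<Rightarrow> bool" where
  "rec4 f \<equiv> total_rec 4 (\<lambda>xs. f (xs ! 0) (xs ! 1) (xs ! 2) (xs ! 3))"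

abbreviation rec5 :: "(nat \<Rightarrow> nat \<Rightarrow> nat \<Rightarrow> nat \<Rightarrow> nat \<Rightarrow> nat) \<Rightarrow> bool" where
  "rec5 f \<equiv> total_rec 5 (\<lambda>xs. f (xs ! 0) (xs ! 1) (xs ! 2) (xs ! 3) (xs ! 4))"

lemma total_recursive2_rec2:
  assumes "total_recursive2 f"
  shows "rec2 f"
  using assms run_oracle_free
  unfolding total_recursive2_def partial_recursive_def total_rec_def by metis

lemma those_map_Some:
  "(\<And>x. x \<in> set xs \<Longrightarrow> f x = Some (g x)) \<Longrightarrow> those (map f xs) = Some (map g xs)"
  by (induction xs) auto

lemma total_rec_comp:
  assumes "total_rec (length \<psi>s) \<phi>" and "\<And>\<psi>. \<psi> \<in> set \<psi>s \<Longrightarrow> total_rec k \<psi>"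
  shows "total_rec k (\<lambda>xs. \<phi> (map (\<lambda>\<psi>. \<psi> xs) \<psi>s))"
proof -
  obtain p where p: "oracle_free p"
    "\<And>A xs. length xs = length \<psi>s \<Longrightarrow> run p A xs = Some (\<phi> xs)"
    using assms(1) unfolding total_rec_def by blast
  obtain P where P: "\<And>\<psi>. \<psi> \<in> set \<psi>s \<Longrightarrow> oracle_free (P \<psi>)"
    "\<And>\<psi> A xs. \<psi> \<in> set \<psi>s \<Longrightarrow> length xs = k \<Longrightarrow> run (P \<psi>) A xs = Some (\<psi> xs)"
    using assms(2) unfolding total_rec_def by metis
  have "run (Comp p (map P \<psi>s)) A xs = Some (\<phi> (map (\<lambda>\<psi>. \<psi> xs) \<psi>s))"
    if "length xs = k" for A xs
    using those_map_Some[of \<psi>s "\<lambda>\<psi>. run (P \<psi>) A xs" "\<lambda>\<psi>. \<psi> xs"] P(2) that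
    by (simp add: p(2) comp_def)
  moreover have "oracle_free (Comp p (map P \<psi>s))"
    using p P by simp
  ultimately show ?thesis unfolding total_rec_def by blast
qed

lemma total_rec_app1:
  assumes "rec1 f" "total_rec k a"
  shows "total_rec k (\<lambda>xs. f (a xs))"
  using total_rec_comp[of "[a]" "\<lambda>xs. f (xs ! 0)" k] assms by simp

lemma total_rec_app2:
  assumes "rec2 f" "total_rec k a" "total_rec k b"
  shows "total_rec k (\<lambda>xs. f (a xs) (b xs))"
  using total_rec_comp[of "[a, b]" "\<lambda>xs. f (xs ! 0) (xs ! 1)" k] assms
  by (auto simp: numeral_eq_Suc)

lemma total_rec_app3:
  assumes "rec3 f" "total_rec k a" "total_rec k b" "total_rec k c"
  shows "total_rec k (\<lambda>xs. f (a xs) (b xs) (c xs))"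
  using total_rec_comp[of "[a, b, c]" "\<lambda>xs. f (xs ! 0) (xs ! 1) (xs ! 2)" k] assms
  by (auto simp: numeral_eq_Suc)

lemma total_rec_app4:
  assumes "rec4 f" "total_rec k a" "total_rec k b" "total_rec k c" "total_rec k d"
  shows "total_rec k (\<lambda>xs. f (a xs) (b xs) (c xs) (d xs))"
  using total_rec_comp[of "[a, b, c, d]" "\<lambda>xs. f (xs ! 0) (xs ! 1) (xs ! 2) (xs ! 3)" k] assms
  by (auto simp: numeral_eq_Suc)

lemma total_rec_nth: "i < k \<Longrightarrow> total_rec k (\<lambda>xs. xs ! i)"
  unfolding total_rec_def by (rule exI[of _ "Proj i"]) simp

lemma total_rec_Suc:
  assumes "total_rec k a"
  shows "total_rec k (\<lambda>xs. Suc (a xs))"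
proof -
  have "rec1 Suc"
    unfolding total_rec_def by (rule exI[of _ "Succ"]) simp
  then show ?thesis using assms by (rule total_rec_app1)
qed

lemma total_rec_const: "total_rec k (\<lambda>_. c)"
proof (induction c)
  case 0
  show ?case unfolding total_rec_def by (rule exI[of _ "Zero"]) simp
qed (rule total_rec_Suc)

text \<open>Separate arities \<open>k1\<close> and \<open>k2\<close>, tied to \<open>k\<close> by
  equations, let the rule match numeral arities.\<close>

lemma total_rec_rec_nat:
  assumes "total_rec k b" and "total_rec k2 s" and "k1 = Suc k" and "k2 = Suc k1"
    and \<phi>: "\<And>n ys. length ys = k \<Longrightarrow> \<phi> (n # ys) = rec_nat (b ys) (\<lambda>n v. s (n # v # ys)) n"
  shows "total_rec k1 \<phi>"
proof -
  obtain p q where p: "oracle_free p" "\<And>A xs. length xs = k \<Longrightarrow> run p A xs = Some (b xs)"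
    and q: "oracle_free q" "\<And>A xs. length xs = Suc (Suc k) \<Longrightarrow> run q A xs = Some (s xs)"
    using assms(1-4) unfolding total_rec_def by metis
  have *: "run (PrimRec p q) A (n # ys) = Some (\<phi> (n # ys))"
    if "length ys = k" for A n ys
    unfolding \<phi>[OF that] using that by (induction n) (auto simp: p q)
  have "run (PrimRec p q) A xs = Some (\<phi> xs)" if "length xs = k1" for A xs
    using that *[of "tl xs" A "hd xs"] \<open>k1 = Suc k\<close> by (cases xs) (simp_all del: run.simps)
  moreover have "oracle_free (PrimRec p q)" using p q by simp
  ultimately show ?thesis unfolding total_rec_def by blast
qed

lemma rec1_rec_nat:
  assumes "rec2 s"
  shows "rec1 (\<lambda>n. rec_nat b s n)"
  by (rule total_rec_rec_nat[OF total_rec_const assms]) simp_all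

lemma rec2_rec_nat:
  assumes "rec1 b" "rec3 s"
  shows "rec2 (\<lambda>n x. rec_nat (b x) (\<lambda>k v. s k v x) n)"
  by (rule total_rec_rec_nat[OF assms]) (simp_all add: numeral_eq_Suc)

lemma rec3_rec_nat:
  assumes "rec2 b" "rec4 s"
  shows "rec3 (\<lambda>n x y. rec_nat (b x y) (\<lambda>k v. s k v x y) n)"
  by (rule total_rec_rec_nat[OF assms]) (simp_all add: numeral_eq_Suc)

lemma rec4_rec_nat:
  assumes "rec3 b" "rec5 s"
  shows "rec4 (\<lambda>n x y z. rec_nat (b x y z) (\<lambda>k v. s k v x y z) n)"
  by (rule total_rec_rec_nat[OF assms]) (simp_all add: numeral_eq_Suc)

text \<open>As \<open>\<phi>\<close> is total, all values before the first zero are defined, so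
  \<open>Mu\<close> stops exactly there.\<close>

lemma total_rec_Least:
  assumes "total_rec k1 \<phi>" and "k1 = Suc k"
    and ex: "\<And>xs. length xs = k \<Longrightarrow> \<exists>n. \<phi> (n # xs) = 0"
  shows "total_rec k (\<lambda>xs. LEAST n. \<phi> (n # xs) = 0)"
proof -
  obtain p where p: "oracle_free p" "\<And>A xs. length xs = Suc k \<Longrightarrow> run p A xs = Some (\<phi> xs)"
    using assms(1,2) unfolding total_rec_def by metis
  have "run (Mu p) A xs = Some (LEAST n. \<phi> (n # xs) = 0)" if len: "length xs = k" for A xs
  proof -
    let ?L = "LEAST n. \<phi> (n # xs) = 0"
    have L: "\<phi> (?L # xs) = 0" by (rule LeastI_ex[OF ex[OF len]])
    have *: "(run p A (n # xs) = Some 0 \<and> (\<forall>m<n. \<exists>v. run p A (m # xs) = Some (Suc v)))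
        \<longleftrightarrow> n = ?L" for n
    proof -
      have "(\<phi> (n # xs) = 0 \<and> (\<forall>m<n. \<phi> (m # xs) \<noteq> 0)) \<longleftrightarrow> n = ?L"
        using L not_less_Least[of _ "\<lambda>n. \<phi> (n # xs) = 0"] by (metis nat_neq_iff)
      then show ?thesis using len by (simp add: p(2) not0_implies_Suc gr0_conv_Suc[symmetric])
    qed
    show ?thesis unfolding run.simps Let_def * by (auto intro: Least_equality)
  qed
  moreover have "oracle_free (Mu p)" using p by simp
  ultimately show ?thesis unfolding total_rec_def by blast
qed

lemma rec1_Least:
  assumes "rec2 \<phi>" "\<And>x. \<exists>n. \<phi> n x = 0"
  shows "rec1 (\<lambda>x. LEAST n. \<phi> n x = 0)"
  using total_rec_Least[OF assms(1), of 1] assms(2) by simp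

lemma rec2_Least:
  assumes "rec3 \<phi>" "\<And>x y. \<exists>n. \<phi> n x y = 0"
  shows "rec2 (\<lambda>x y. LEAST n. \<phi> n x y = 0)"
  using total_rec_Least[OF assms(1), of 2] assms(2) by (simp add: numeral_eq_Suc)

section \<open>Closure under arithmetic\<close>

lemma total_rec_add:
  assumes "total_rec k a" "total_rec k b"
  shows "total_rec k (\<lambda>xs. a xs + b xs)"
proof -
  have "rec2 (\<lambda>n x. rec_nat x (\<lambda>k v. Suc v) n)"
    by (intro rec2_rec_nat total_rec_nth total_rec_Suc) simp_all
  moreover have "rec_nat x (\<lambda>k v. Suc v) n = n + x" for n x :: nat
    by (induction n) simp_all
  ultimately have "rec2 (\<lambda>n x. n + x)" by simp
  then show ?thesis using assms by (rule total_rec_app2)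
qed

lemma total_rec_mult:
  assumes "total_rec k a" "total_rec k b"
  shows "total_rec k (\<lambda>xs. a xs * b xs)"
proof -
  have "rec2 (\<lambda>n x. rec_nat 0 (\<lambda>k v. x + v) n)"
    by (intro rec2_rec_nat total_rec_nth total_rec_const total_rec_add) simp_all
  moreover have "rec_nat 0 (\<lambda>k v. x + v) n = n * x" for n x :: nat
    by (induction n) simp_all
  ultimately have "rec2 (\<lambda>n x. n * x)" by simp
  then show ?thesis using assms by (rule total_rec_app2)
qed

lemma total_rec_diff:
  assumes "total_rec k a" "total_rec k b"
  shows "total_rec k (\<lambda>xs. a xs - b xs)"
proof -
  have "rec1 (\<lambda>n. rec_nat 0 (\<lambda>k v. k) n)"
    by (intro rec1_rec_nat total_rec_nth) simp_all
  moreover have "rec_nat 0 (\<lambda>k v. k) n = n - 1" for n :: nat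
    by (cases n) simp_all
  ultimately have pred: "rec1 (\<lambda>n. n - 1)" by simp
  have "rec2 (\<lambda>n x. rec_nat x (\<lambda>k v. v - 1) n)"
    by (intro rec2_rec_nat total_rec_app1[OF pred] total_rec_nth) simp_all
  moreover have "rec_nat x (\<lambda>k v. v - 1) n = x - n" for n x :: nat
    by (induction n) simp_all
  ultimately have "rec2 (\<lambda>n x. x - n)" by simp
  then show ?thesis using assms(2,1) by (rule total_rec_app2)
qed

lemma total_rec_power:
  assumes "total_rec k a"
  shows "total_rec k (\<lambda>xs. c ^ a xs)"
proof -
  have "rec1 (\<lambda>n. rec_nat 1 (\<lambda>k v. c * v) n)"
    by (intro rec1_rec_nat total_rec_mult total_rec_const total_rec_nth) simp_all
  moreover have "rec_nat 1 (\<lambda>k v. c * v) n = c ^ n" for n :: nat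
    by (induction n) simp_all
  ultimately have "rec1 (\<lambda>n. c ^ n)" by simp
  then show ?thesis using assms by (rule total_rec_app1)
qed

text \<open>The quotient is the first \<open>q\<close> with \<open>a < Suc q * b\<close>. The extra
  factor \<open>b\<close> makes the search stop at 0 when \<open>b = 0\<close>, in agreement with
  \<open>a div 0 = 0\<close>.\<close>

lemma total_rec_div:
  assumes "total_rec k a" "total_rec k b"
  shows "total_rec k (\<lambda>xs. a xs div b xs)"
proof -
  have eq: "((Suc a - Suc q * b) * b = 0) = (a < Suc q * b \<or> b = 0)" for q a b :: nat
    by auto
  have least: "(LEAST q. (Suc a - Suc q * b) * b = 0) = a div b" for a b :: nat
  proof (rule Least_equality)
    show "(Suc a - Suc (a div b) * b) * b = 0"
      unfolding eq by (metis dividend_less_div_times mult_Suc neq0_conv)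
    fix q assume "(Suc a - Suc q * b) * b = 0"
    then show "a div b \<le> q"
      unfolding eq by (metis div_by_0 less_Suc_eq_le less_mult_imp_div_less zero_le)
  qed
  have "rec2 (\<lambda>a b. LEAST q. (Suc a - Suc q * b) * b = 0)"
  proof (intro rec2_Least total_rec_mult total_rec_diff total_rec_Suc total_rec_nth)
    show "\<exists>q. (Suc a - Suc q * b) * b = 0" for a b :: nat
      unfolding eq by (metis dividend_less_div_times mult_Suc neq0_conv)
  qed simp_all
  then have "rec2 (\<lambda>a b. a div b)" unfolding least .
  then show ?thesis using assms by (rule total_rec_app2)
qed

lemma total_rec_mod:
  assumes "total_rec k a" "total_rec k b"
  shows "total_rec k (\<lambda>xs. a xs mod b xs)"
  unfolding minus_mult_div_eq_mod[symmetric]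
  by (intro total_rec_diff total_rec_mult total_rec_div assms)

lemmas total_rec_intros = total_rec_nth total_rec_const total_rec_Suc total_rec_add
  total_rec_mult total_rec_diff total_rec_power total_rec_div total_rec_mod

section \<open>Codes of strings\<close>

abbreviation str_decode :: "nat \<Rightarrow> bool list" where
  "str_decode \<equiv> inv str_code"

lemma str_code_decode: "str_code (str_decode x) = x"
  by (simp add: bij_str_code bij_is_surj surj_f_inv_f)

lemma str_decode_code: "str_decode (str_code \<sigma>) = \<sigma>"
  by (simp add: bij_str_code bij_is_inj)

lemma str_code_append: "str_code (\<sigma> @ \<tau>) = str_code \<sigma> + 2 ^ length \<sigma> * str_code \<tau>"
  by (induction \<sigma>) (auto simp: algebra_simps)

text \<open>In bijective base 2, \<open>(v - 1) div 2\<close> removes the first digit and fixes 0,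
  the code of the empty string.\<close>

definition drop_code :: "nat \<Rightarrow> nat \<Rightarrow> nat" where
  "drop_code n x = rec_nat x (\<lambda>_ v. (v - 1) div 2) n"

lemma drop_code_str_code: "drop_code n (str_code \<sigma>) = str_code (drop n \<sigma>)"
proof (induction n)
  case (Suc n)
  have "drop_code (Suc n) (str_code \<sigma>) = (str_code (drop n \<sigma>) - 1) div 2"
    using Suc by (simp add: drop_code_def)
  also have "\<dots> = str_code (tl (drop n \<sigma>))"
    by (cases "drop n \<sigma>") auto
  finally show ?case by (simp add: drop_Suc tl_drop)
qed (simp add: drop_code_def)

lemma total_rec_drop_code:
  assumes "total_rec k a" "total_rec k b"
  shows "total_rec k (\<lambda>xs. drop_code (a xs) (b xs))"
proof -
  have "rec2 drop_code"
    unfolding drop_code_def by (intro rec2_rec_nat total_rec_intros) simp_all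
  then show ?thesis using assms by (rule total_rec_app2)
qed

lemma str_code_take: "str_code (take n \<sigma>) = str_code \<sigma> - 2 ^ n * str_code (drop n \<sigma>)"
proof (cases "n \<le> length \<sigma>")
  case True
  then have "str_code \<sigma> = str_code (take n \<sigma>) + 2 ^ n * str_code (drop n \<sigma>)"
    by (metis append_take_drop_id length_take min.absorb2 str_code_append)
  then show ?thesis by linarith
qed simp

text \<open>The parity of a nonzero code is that of its first digit: 2 for \<open>True\<close>, 1
  for \<open>False\<close>.\<close>

lemma str_code_drop_mod:
  assumes "n < length \<sigma>"
  shows "2 - str_code (drop n \<sigma>) mod 2 = (if \<sigma> ! n then 2 else 1)"
  by (simp add: Cons_nth_drop_Suc[OF assms, symmetric])

lemma str_code_map:
  "str_code (map b [0..<n]) = rec_nat 0 (\<lambda>j v. v + 2 ^ j * (if b j then 2 else 1)) n"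
  by (induction n) (simp_all add: str_code_append)

lemma str_code_bounds: "2 ^ length \<sigma> \<le> Suc (str_code \<sigma>) \<and> Suc (str_code \<sigma>) < 2 * 2 ^ length \<sigma>"
  by (induction \<sigma>) auto

text \<open>By \<open>str_code_bounds\<close>, codes of strings of different lengths lie in disjoint
  intervals.\<close>

lemma ex_str_code:
  assumes "2 ^ n \<le> Suc r" "Suc r < 2 * 2 ^ n"
  obtains w where "length w = n" "str_code w = r"
proof -
  define w where "w = str_decode r"
  have r: "str_code w = r" by (simp add: w_def str_code_decode)
  have "2 ^ length w < (2::nat) ^ Suc n" "2 ^ n < (2::nat) ^ Suc (length w)"
    using str_code_bounds[of w] assms r by auto
  then have "length w = n"
    using power_strict_increasing_iff[of "2::nat"] by (simp del: power_Suc)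
  with r that show ?thesis by blast
qed

section \<open>Prefix-free machines\<close>

text \<open>\<open>U\<close> simulates the machine whose only program is the empty string, with
  output \<open>\<tau>\<close>.\<close>

lemma ex_program:
  assumes "universal_machine U"
  obtains \<sigma> where "U \<sigma> = Some \<tau>"
proof -
  define M where "M \<sigma> = (if \<sigma> = [] then Some \<tau> else None)" for \<sigma> :: "bool list"
  define F where "F xs = (if xs ! 0 = 0 then Some (str_code \<tau>) else None)" for xs :: "nat list"
  obtain p where p: "oracle_free p"
    "\<And>A xs. length xs = 1 \<Longrightarrow> run p A xs = Some (str_code \<tau>)"
    using total_rec_const[of 1 "str_code \<tau>"] unfolding total_rec_def by blast
  \<comment> \<open>\<open>Mu (Proj 1)\<close> tests the input: it returns 0 on input 0 and diverges
    otherwise, as \<open>Proj 1\<close> ignores the search variable.\<close>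
  have "run (Comp p [Mu (Proj 1)]) A xs = F xs" if "length xs = 1" for A xs
    using that by (auto simp: p(2) F_def nth_Cons split: nat.splits)
  moreover have "oracle_free (Comp p [Mu (Proj 1)])" using p by simp
  ultimately have "partial_recursive 1 F"
    unfolding partial_recursive_def by blast
  moreover have "F [str_code \<sigma>] = map_option str_code (M \<sigma>)" for \<sigma>
    by (cases \<sigma>) (auto simp: F_def M_def)
  moreover have "\<sigma> = []" if "\<sigma> \<in> dom M" for \<sigma>
    using that by (auto simp: M_def split: if_splits)
  ultimately have "prefix_free_machine M"
    unfolding prefix_free_machine_def by metis
  then obtain \<rho> where "\<And>\<sigma>. U (\<rho> @ \<sigma>) = M \<sigma>"
    using assms unfolding universal_machine_def by blast
  from this[of "[]"] show ?thesis by (intro that[of "\<rho> @ []"]) (simp add: M_def)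
qed

text \<open>If the empty program halted, prefix-freeness would make it the only program and leave
  just one output.\<close>

lemma universal_machine_Nil:
  assumes "universal_machine U"
  shows "U [] = None"
proof (rule ccontr)
  assume "U [] \<noteq> None"
  then have "\<sigma> = []" if "U \<sigma> \<noteq> None" for \<sigma>
    using assms that unfolding universal_machine_def prefix_free_machine_def
    by (metis Nil_prefix domIff)
  then show False
    using ex_program[OF assms, of "[]"] ex_program[OF assms, of "[True]"]
    by (metis list.distinct(1) option.distinct(1) option.inject)
qed

lemma K_le: "U \<sigma> = Some \<tau> \<Longrightarrow> K U \<tau> \<le> length \<sigma>"
  unfolding K_def by (rule Least_le) auto

lemma K_attained:
  assumes "universal_machine U"
  obtains \<sigma> where "U \<sigma> = Some \<tau>" "length \<sigma> = K U \<tau>"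
proof -
  obtain \<sigma> where "U \<sigma> = Some \<tau>" by (rule ex_program[OF assms])
  then have "\<exists>n \<sigma>. length \<sigma> = n \<and> U \<sigma> = Some \<tau>" by blast
  from LeastI_ex[OF this] that show ?thesis unfolding K_def by blast
qed

text \<open>The product vanishes exactly when the remaining code is 0 or odd: no bit is left, or the
  next bit is \<open>False\<close>.\<close>

definition lead_ones_code :: "nat \<Rightarrow> nat" where
  "lead_ones_code x = (LEAST k. drop_code k x * (1 - drop_code k x mod 2) = 0)"

abbreviation lead_ones :: "bool list \<Rightarrow> nat" where
  "lead_ones \<rho> \<equiv> length (takeWhile id \<rho>)"

lemma drop_lead_ones_code:
  "drop_code (lead_ones \<rho>) (str_code \<rho>) * (1 - drop_code (lead_ones \<rho>) (str_code \<rho>) mod 2) = 0"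
proof -
  have "drop (lead_ones \<rho>) \<rho> = dropWhile id \<rho>"
    by (simp add: dropWhile_eq_drop)
  then show ?thesis
    unfolding drop_code_str_code using hd_dropWhile[of id \<rho>] by (cases "dropWhile id \<rho>") auto
qed

lemma lead_ones_code: "lead_ones_code (str_code \<rho>) = lead_ones \<rho>"
  unfolding lead_ones_code_def
proof (rule Least_equality, rule drop_lead_ones_code)
  fix k assume *: "drop_code k (str_code \<rho>) * (1 - drop_code k (str_code \<rho>) mod 2) = 0"
  show "lead_ones \<rho> \<le> k"
  proof (rule ccontr)
    assume k: "\<not> lead_ones \<rho> \<le> k"
    then have "\<rho> ! k" using nth_mem[of k "takeWhile id \<rho>"] set_takeWhileD[of "takeWhile id \<rho> ! k" id \<rho>]
      by (simp add: takeWhile_nth)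
    moreover have len: "k < length \<rho>" using k length_takeWhile_le[of id \<rho>] by linarith
    ultimately show False
      using * unfolding drop_code_str_code Cons_nth_drop_Suc[OF len, symmetric] by simp
  qed
qed

lemma rec1_lead_ones_code: "rec1 lead_ones_code"
  unfolding lead_ones_code_def
proof (intro rec1_Least total_rec_drop_code total_rec_intros)
  show "\<exists>k. drop_code k x * (1 - drop_code k x mod 2) = 0" for x
    using drop_lead_ones_code[of "str_decode x"] unfolding str_code_decode by blast
qed simp_all

text \<open>A program \<open>\<rho> = 1\<^sup>m 0 w \<sigma>\<close> with \<open>|w| = m\<close> is decoded from \<open>m\<close>, \<open>w\<close> and \<open>U(\<sigma>)\<close>. Since
  \<^term>\<open>[]\<close> is not in the domain of \<open>U\<close>, no string that is too short to be parsed is in the domain.\<close>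

definition decoding_machine ::
  "(bool list \<Rightarrow> bool list option) \<Rightarrow> (nat \<Rightarrow> nat \<Rightarrow> nat \<Rightarrow> nat) \<Rightarrow> bool list \<Rightarrow> bool list option" where
  "decoding_machine U out \<rho> =
     (let m = lead_ones \<rho>; \<rho>' = drop (Suc m) \<rho>
      in map_option (\<lambda>\<tau>. str_decode (out m (str_code (take m \<rho>')) (str_code \<tau>))) (U (drop m \<rho>')))"

text \<open>The unary header fixes where the part for \<open>U\<close> starts, so comparable
  programs have comparable parts for \<open>U\<close>, and these coincide because \<open>U\<close>
  is prefix-free.\<close>

lemma prefix_free_decoding_machine:
  assumes U: "universal_machine U" and out: "rec3 out"
  shows "prefix_free_machine (decoding_machine U out)"
proof -
  \<comment> \<open>On codes, \<open>D\<close> cuts off the header with its \<open>False\<close>,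
    \<open>S\<close> is the program for \<open>U\<close>, and \<open>W\<close> is the string
    \<open>w\<close>.\<close>
  define D where "D x = drop_code (Suc (lead_ones_code x)) x" for x
  define S where "S x = drop_code (lead_ones_code x) (D x)" for x
  define W where "W x = D x - 2 ^ lead_ones_code x * S x" for x
  have "rec1 S" "rec1 W"
    unfolding W_def S_def D_def
    by (intro total_rec_drop_code total_rec_app1[OF rec1_lead_ones_code] total_rec_intros; simp)+
  then obtain pL pS pW po where programs: "oracle_free pL" "oracle_free pS" "oracle_free pW" "oracle_free po"
    "\<And>A x. run pL A [x] = Some (lead_ones_code x)"
    "\<And>A x. run pS A [x] = Some (S x)"
    "\<And>A x. run pW A [x] = Some (W x)"
    "\<And>A x y z. run po A [x, y, z] = Some (out x y z)"
    using rec1_lead_ones_code out unfolding total_rec_def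
    by (auto simp: numeral_eq_Suc length_Suc_conv)
  obtain F where "partial_recursive 1 F" "\<And>\<sigma>. F [str_code \<sigma>] = map_option str_code (U \<sigma>)"
    using U unfolding universal_machine_def prefix_free_machine_def by blast
  then obtain p where p: "oracle_free p"
    "\<And>\<sigma>. run p (\<lambda>_. 0) [str_code \<sigma>] = map_option str_code (U \<sigma>)"
    unfolding partial_recursive_def by force
  define q where "q = Comp po [pL, pW, Comp p [pS]]"
  have "partial_recursive 1 (run q (\<lambda>_. 0))"
    unfolding partial_recursive_def using programs p by (intro exI[of _ q]) (simp add: q_def)
  moreover have "run q (\<lambda>_. 0) [str_code \<rho>] = map_option str_code (decoding_machine U out \<rho>)" for \<rho>
  proof -
    define m where "m = lead_ones \<rho>"
    have "D (str_code \<rho>) = str_code (drop (Suc m) \<rho>)"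
      by (simp add: D_def m_def lead_ones_code drop_code_str_code)
    then have "S (str_code \<rho>) = str_code (drop m (drop (Suc m) \<rho>))"
      "W (str_code \<rho>) = str_code (take m (drop (Suc m) \<rho>))"
      by (simp_all only: S_def W_def m_def lead_ones_code drop_code_str_code str_code_take)
    then show ?thesis
      unfolding q_def decoding_machine_def Let_def m_def[symmetric]
      by (cases "U (drop m (drop (Suc m) \<rho>))")
         (simp_all add: programs p lead_ones_code m_def[symmetric] str_code_decode del: drop_drop)
  qed
  moreover have "\<rho> = \<rho>'"
    if "\<rho> \<in> dom (decoding_machine U out)" "\<rho>' \<in> dom (decoding_machine U out)" "prefix \<rho> \<rho>'" for \<rho> \<rho>'
  proof -
    define m where "m = lead_ones \<rho>"
    obtain \<eta> where \<rho>': "\<rho>' = \<rho> @ \<eta>" using \<open>prefix \<rho> \<rho>'\<close> by (auto elim: prefixE)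
    have dom: "U (drop m (drop (Suc m) \<rho>)) \<noteq> None"
      using that(1) by (auto simp: decoding_machine_def Let_def m_def)
    \<comment> \<open>A nonempty part for \<open>U\<close> means that the header and
      \<open>w\<close> are complete, so every extension of \<open>\<rho>\<close> is parsed in the
      same way.\<close>
    with universal_machine_Nil[OF U] have "drop m (drop (Suc m) \<rho>) \<noteq> []"
      by metis
    then have len: "m + Suc m < length \<rho>" by simp
    have "takeWhile id \<rho>' = takeWhile id \<rho>"
    proof -
      have "\<exists>b\<in>set \<rho>. \<not> b"
      proof (rule ccontr)
        assume "\<not> (\<exists>b\<in>set \<rho>. \<not> b)"
        then have "takeWhile id \<rho> = \<rho>" by (simp add: takeWhile_eq_all_conv)
        then have "m = length \<rho>" unfolding m_def by (rule arg_cong)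
        then show False using len by simp
      qed
      then show ?thesis unfolding \<rho>' by (auto simp: takeWhile_append1)
    qed
    then have "U (drop m (drop (Suc m) \<rho>')) \<noteq> None"
      using that(2) by (auto simp: decoding_machine_def Let_def m_def)
    moreover have "prefix (drop m (drop (Suc m) \<rho>)) (drop m (drop (Suc m) \<rho>'))"
      using len unfolding \<rho>' by simp
    ultimately have "drop m (drop (Suc m) \<rho>) = drop m (drop (Suc m) \<rho>')"
      using U dom unfolding universal_machine_def prefix_free_machine_def by blast
    then show ?thesis using len \<rho>' by simp
  qed
  ultimately show ?thesis unfolding prefix_free_machine_def by blast
qed

text \<open>Stating \<open>length w\<close> in unary doubles the cost of \<open>w\<close>;
  \<open>c\<close> pays for the delimiter and for the prefix \<open>\<pi>\<close> that selects the
  decoding machine.\<close>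

lemma K_decode:
  assumes U: "universal_machine U" and out: "rec3 out"
  obtains c where "\<And>w \<tau> \<tau>'. out (length w) (str_code w) (str_code \<tau>) = str_code \<tau>' \<Longrightarrow>
    K U \<tau>' \<le> K U \<tau> + 2 * length w + c"
proof -
  obtain \<pi> where \<pi>: "\<And>\<rho>. U (\<pi> @ \<rho>) = decoding_machine U out \<rho>"
    using U prefix_free_decoding_machine[OF U out] unfolding universal_machine_def by blast
  have "K U \<tau>' \<le> K U \<tau> + 2 * length w + Suc (length \<pi>)"
    if "out (length w) (str_code w) (str_code \<tau>) = str_code \<tau>'" for w \<tau> \<tau>'
  proof -
    obtain \<sigma> where \<sigma>: "U \<sigma> = Some \<tau>" "length \<sigma> = K U \<tau>" by (rule K_attained[OF U])
    define \<rho> where "\<rho> = replicate (length w) True @ False # w @ \<sigma>"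
    have "takeWhile id \<rho> = replicate (length w) True"
      unfolding \<rho>_def by (subst takeWhile_append2) auto
    then have "decoding_machine U out \<rho> = Some \<tau>'"
      unfolding decoding_machine_def Let_def by (simp add: \<rho>_def \<sigma> that str_decode_code)
    then have "K U \<tau>' \<le> length (\<pi> @ \<rho>)" by (intro K_le) (simp add: \<pi>)
    also have "\<dots> = K U \<tau> + 2 * length w + Suc (length \<pi>)" by (simp add: \<rho>_def \<sigma>)
    finally show ?thesis .
  qed
  then show ?thesis using that by blast
qed

section \<open>A Toeplitz construction\<close>

text \<open>At level \<open>i\<close> the line is cut into blocks of length \<open>2\<^bsup>m0+i\<^esup>\<close>; in each of them the first \<open>g i\<close>
  positions that no earlier level has used are given to level \<open>i\<close>, and they hold the source indices
  \<open>0, \<dots>, g i - 1\<close>. \<open>free i\<close> is the number of positions of a block that are unused before level \<open>i\<close>,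
  \<open>rank i\<close> numbers all the unused positions, and \<open>pos i\<close> inverts \<open>rank i\<close>.\<close>

locale toeplitz =
  fixes g :: "nat \<Rightarrow> nat" and m0 :: nat
begin

primrec free :: "nat \<Rightarrow> nat" where
  "free 0 = 2 ^ m0"
| "free (Suc i) = 2 * (free i - g i)"

text \<open>Every block up to and including the one numbered \<open>rank i x div free i\<close>
  gives \<open>g i\<close> smaller numbers to level \<open>i\<close>. A position taken at level
  \<open>i\<close> gets meaningless values from then on; \<open>source\<close> never reads them, as
  \<open>level\<close> stops at \<open>i\<close>.\<close>

primrec rank :: "nat \<Rightarrow> nat \<Rightarrow> nat" where
  "rank 0 x = x"
| "rank (Suc i) x = rank i x - Suc (rank i x div free i) * g i"

definition skip :: "nat \<Rightarrow> nat \<Rightarrow> nat" where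
  "skip i y = y div (free i - g i) * free i + (y mod (free i - g i) + g i)"

primrec pos :: "nat \<Rightarrow> nat \<Rightarrow> nat" where
  "pos 0 y = y"
| "pos (Suc i) y = pos i (skip i y)"

definition level :: "nat \<Rightarrow> nat" where
  "level x = (LEAST i. Suc (rank i x mod free i) - g i = 0)"

definition source :: "nat \<Rightarrow> nat" where
  "source x = rank (level x) x mod free (level x)"

text \<open>The arguments are those of \<open>out\<close> in \<open>decoding_machine\<close>: the
  length and the code of \<open>w\<close>, and the code of \<open>\<tau>\<close>. The code
  \<open>r\<close> of \<open>w\<close> is itself the offset of the block.\<close>

definition read_bits :: "nat \<Rightarrow> nat \<Rightarrow> nat \<Rightarrow> nat" where
  "read_bits m r t =
     rec_nat 0 (\<lambda>j v. v + 2 ^ j * (2 - drop_code (r + pos (m - m0) j) t mod 2)) (g (m - m0))"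

lemma read_bits_eq:
  assumes "\<And>j. j < g (m - m0) \<Longrightarrow> r + pos (m - m0) j < length \<tau> \<and> \<tau> ! (r + pos (m - m0) j) = b j"
  shows "read_bits m r (str_code \<tau>) = str_code (map b [0..<g (m - m0)])"
proof -
  have "rec_nat 0 (\<lambda>j v. v + 2 ^ j * (2 - drop_code (r + pos (m - m0) j) (str_code \<tau>) mod 2)) n
      = rec_nat 0 (\<lambda>j v. v + 2 ^ j * (if b j then 2 else 1)) n" if "n \<le> g (m - m0)" for n
    using that by (induction n) (auto simp: drop_code_str_code str_code_drop_mod assms)
  then show ?thesis unfolding read_bits_def str_code_map by simp
qed

end

section \<open>Recursiveness of the Toeplitz map\<close>

locale toeplitz_rec = toeplitz +
  assumes rec1_g: "rec1 g" and g_pos: "\<And>i. 0 < g i"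
begin

lemma rec1_free: "rec1 free"
proof -
  have "rec1 (\<lambda>i. rec_nat (2 ^ m0) (\<lambda>i v. 2 * (v - g i)) i)"
    by (intro rec1_rec_nat total_rec_app1[OF rec1_g] total_rec_intros) simp_all
  moreover have "rec_nat (2 ^ m0) (\<lambda>i v. 2 * (v - g i)) i = free i" for i
    by (induction i) simp_all
  ultimately show ?thesis by simp
qed

lemma rec2_rank: "rec2 rank"
proof -
  have "rec2 (\<lambda>i x. rec_nat x (\<lambda>i v. v - Suc (v div free i) * g i) i)"
    by (intro rec2_rec_nat total_rec_app1[OF rec1_g] total_rec_app1[OF rec1_free] total_rec_intros)
       simp_all
  moreover have "rec_nat x (\<lambda>i v. v - Suc (v div free i) * g i) i = rank i x" for i x
    by (induction i) simp_all
  ultimately show ?thesis by simp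
qed

lemma rec2_skip: "rec2 skip"
  unfolding skip_def
  by (intro total_rec_app1[OF rec1_g] total_rec_app1[OF rec1_free] total_rec_intros) simp_all

text \<open>The recursion of \<open>pos\<close> changes its parameter \<open>y\<close>, so it is
  recast as an iteration of \<open>skip\<close> over the levels from \<open>i - 1\<close> down to
  0.\<close>

lemma rec2_pos: "rec2 pos"
proof -
  have "pos i y = pos (i - n) (rec_nat y (\<lambda>k v. skip (i - 1 - k) v) n)" if "n \<le> i" for i n y
    using that
  proof (induction n)
    case (Suc n)
    then have "i - n = Suc (i - Suc n)" by simp
    then show ?case using Suc by simp
  qed simp
  from this[OF order_refl] have eq: "rec_nat y (\<lambda>k v. skip (i - 1 - k) v) i = pos i y" for i y
    by simp
  have "rec3 (\<lambda>n i y. rec_nat y (\<lambda>k v. skip (i - 1 - k) v) n)"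
    by (intro rec3_rec_nat total_rec_app2[OF rec2_skip] total_rec_intros) simp_all
  from total_rec_app3[OF this, of 2 "\<lambda>xs. xs ! 0" "\<lambda>xs. xs ! 0" "\<lambda>xs. xs ! 1"]
  show ?thesis unfolding eq by (simp add: total_rec_nth)
qed

text \<open>As \<open>g\<close> is positive, each level lowers a nonzero rank. Hence the search in
  \<open>level\<close> ends.\<close>

lemma rank_eventually_0: "x \<le> i \<Longrightarrow> rank i x = 0"
proof -
  have "rank i x \<le> x - i" for i
  proof (induction i)
    case (Suc i)
    have "rank (Suc i) x \<le> rank i x - 1"
      using g_pos[of i] by (simp add: diff_le_mono2 Suc_leI)
    then show ?case using Suc by linarith
  qed simp
  then show "x \<le> i \<Longrightarrow> rank i x = 0" by (metis diff_is_0_eq le_zero_eq)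
qed

lemma rec1_source: "rec1 source"
proof -
  have level: "rec1 level"
    unfolding level_def
  proof (intro rec1_Least total_rec_app1[OF rec1_g] total_rec_app1[OF rec1_free]
      total_rec_app2[OF rec2_rank] total_rec_intros)
    show "\<exists>i. Suc (rank i x mod free i) - g i = 0" for x
      using rank_eventually_0[of x x] g_pos[of x] by (intro exI[of _ x]) simp
  qed simp_all
  show ?thesis
    unfolding source_def
    by (intro total_rec_app1[OF rec1_free] total_rec_app2[OF rec2_rank] total_rec_app1[OF level]
        total_rec_intros) simp_all
qed

lemma rec3_read_bits: "rec3 read_bits"
proof -
  have "rec4 (\<lambda>n m r t.
      rec_nat 0 (\<lambda>j v. v + 2 ^ j * (2 - drop_code (r + pos (m - m0) j) t mod 2)) n)"
    by (intro rec4_rec_nat total_rec_app2[OF rec2_pos] total_rec_drop_code total_rec_intros) simp_all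
  then show ?thesis
    unfolding read_bits_def by (rule total_rec_app4) (intro total_rec_app1[OF rec1_g] total_rec_intros; simp)+
qed

end

section \<open>Room for all levels, and the location of the copies\<close>

locale toeplitz_space = toeplitz_rec +
  assumes g_sum: "\<And>i. (\<Sum>j\<le>i. real (g j) / 2 ^ j) < 2 ^ m0"
begin

text \<open>Doubling at each level gives \<open>free i = 2 ^ i * (2 ^ m0 - S)\<close>, where
  \<open>S\<close> sums \<open>g j / 2 ^ j\<close> over \<open>j < i\<close>; by
  \<open>g_sum\<close> the next summand still fits.\<close>

lemma g_less_free: "g i < free i"
proof -
  \<comment> \<open>The induction below uses this implication at each stage: it makes the natural
    subtraction in \<open>free (Suc i)\<close> exact.\<close>
  have *: "real (free i) = 2 ^ i * (2 ^ m0 - (\<Sum>j<i. real (g j) / 2 ^ j)) \<Longrightarrow> g i < free i" for i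
  proof -
    assume free: "real (free i) = 2 ^ i * (2 ^ m0 - (\<Sum>j<i. real (g j) / 2 ^ j))"
    have "real (g i) / 2 ^ i < 2 ^ m0 - (\<Sum>j<i. real (g j) / 2 ^ j)"
      using g_sum[of i] by (simp add: lessThan_Suc_atMost[symmetric])
    then have "real (g i) < real (free i)"
      unfolding free by (simp add: field_simps)
    then show ?thesis by simp
  qed
  have "real (free i) = 2 ^ i * (2 ^ m0 - (\<Sum>j<i. real (g j) / 2 ^ j))"
  proof (induction i)
    case (Suc i)
    have "real (free (Suc i)) = 2 * (real (free i) - real (g i))"
      using *[OF Suc] by (simp add: of_nat_diff)
    also have "\<dots> = 2 ^ Suc i * (2 ^ m0 - (\<Sum>j<Suc i. real (g j) / 2 ^ j))"
      unfolding Suc.IH by (simp add: algebra_simps del: free.simps)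
    finally show ?case .
  qed simp
  then show ?thesis by (rule *)
qed

lemma rank_skip:
  "skip i y - Suc (skip i y div free i) * g i = y" "g i \<le> skip i y mod free i"
proof -
  define q where "q = y div (free i - g i)"
  define s where "s = y mod (free i - g i)"
  have "s < free i - g i" using g_less_free[of i] by (simp add: s_def)
  then have s: "s + g i < free i" by linarith
  have skip: "skip i y = q * free i + (s + g i)" by (simp add: skip_def q_def s_def)
  have div: "skip i y div free i = q" and "skip i y mod free i = s + g i"
    unfolding skip using s by simp_all
  then show "g i \<le> skip i y mod free i" by simp
  have "q * free i = q * (free i - g i) + q * g i"
    using g_less_free[of i] by (metis add_mult_distrib2 le_add_diff_inverse2 less_imp_le_nat)
  moreover have "q * (free i - g i) + s = y"
    unfolding q_def s_def by (rule div_mult_mod_eq)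
  ultimately show "skip i y - Suc (skip i y div free i) * g i = y"
    unfolding div unfolding skip by simp
qed

text \<open>By \<open>rank_skip\<close>, each step of \<open>pos\<close> undoes one step of
  \<open>rank\<close> and avoids the numbers claimed at that level.\<close>

lemma rank_pos: "rank i (pos i y) = y \<and> (\<forall>k<i. g k \<le> rank k (pos i y) mod free k)"
proof (induction i arbitrary: y)
  case (Suc i)
  then show ?case using rank_skip[of i y] by (auto simp: less_Suc_eq)
qed simp

lemma source_pos:
  assumes "j < g i"
  shows "source (pos i (q * free i + j)) = j"
proof -
  let ?x = "pos i (q * free i + j)"
  have mod: "rank i ?x mod free i = j"
    using rank_pos assms g_less_free[of i] by simp
  have "level ?x = i"
    unfolding level_def
  proof (rule Least_equality)
    show "Suc (rank i ?x mod free i) - g i = 0" using mod assms by simp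
    fix k assume "Suc (rank k ?x mod free k) - g k = 0"
    then have "\<not> g k \<le> rank k ?x mod free k" by simp
    then show "i \<le> k" using rank_pos[of i] by (meson not_le)
  qed
  then show ?thesis using mod by (simp add: source_def)
qed

text \<open>The layout of the levels below \<open>i\<close> repeats with the block length. In the
  induction \<open>q\<close> doubles, as a block of level \<open>Suc i\<close> consists of two
  blocks of level \<open>i\<close>.\<close>

lemma pos_shift: "pos i (q * free i + y) = q * (2 ^ m0 * 2 ^ i) + pos i y"
proof (induction i arbitrary: q y)
  case (Suc i)
  have "0 < free i - g i" using g_less_free[of i] by simp
  then have "(q * free (Suc i) + y) div (free i - g i) = 2 * q + y div (free i - g i)"
    "(q * free (Suc i) + y) mod (free i - g i) = y mod (free i - g i)"
    using div_mult_self3[of "free i - g i" "2 * q" y] mod_mult_self3[of "2 * q" "free i - g i" y]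
    by (simp_all add: mult.assoc mult.left_commute[of q 2])
  then have "skip i (q * free (Suc i) + y) = (2 * q) * free i + skip i y"
    by (simp add: skip_def algebra_simps)
  then show ?case using Suc[of "2 * q" "skip i y"] by (simp add: mult.left_commute)
qed simp

lemma pos_less: "y < q * free i \<Longrightarrow> pos i y < q * (2 ^ m0 * 2 ^ i)"
proof (induction i arbitrary: q y)
  case (Suc i)
  have pos: "0 < free i - g i" using g_less_free[of i] by simp
  have "y < 2 * q * (free i - g i)" using Suc.prems by (simp add: ac_simps)
  then have "y div (free i - g i) < 2 * q" by (simp add: less_mult_imp_div_less)
  then have "Suc (y div (free i - g i)) * free i \<le> 2 * q * free i"
    by (intro mult_le_mono1) simp
  moreover have "y mod (free i - g i) + g i < free i"
    using mod_less_divisor[OF pos, of y] by simp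
  ultimately have "skip i y < 2 * q * free i" by (simp add: skip_def)
  from Suc.IH[OF this] show ?case by (simp add: ac_simps)
qed simp

text \<open>A window of length \<open>4 \<cdot> 2\<^sup>m\<close> contains an aligned block of length \<open>2\<^sup>m\<close> that starts at an
  offset \<open>r\<close> for which some string of length \<open>m\<close> has code \<open>r\<close>.\<close>

lemma ex_read_bits:
  assumes "m0 \<le> m" "4 * 2 ^ m \<le> s' - s"
  obtains w where "length w = m"
    "read_bits m (str_code w) (str_code (map (X \<circ> source) [s..<s'])) = str_code (map X [0..<g (m - m0)])"
proof -
  define i where "i = m - m0"
  define L :: nat where "L = 2 ^ m"
  have L: "2 ^ m0 * 2 ^ i = L" "0 < L" using assms(1) by (simp_all add: L_def i_def flip: power_add)
  \<comment> \<open>\<open>q * L\<close> is the only multiple of \<open>L\<close> from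
    \<open>s + L - 1\<close> to \<open>s + 2 * L - 2\<close>, so \<open>r\<close> runs from
    \<open>L - 1\<close> to \<open>2 * L - 2\<close>, the exact range of codes of strings of length
    \<open>m\<close>.\<close>
  define q where "q = (s + 2 * L - 2) div L"
  have "q * L \<le> s + 2 * L - 2" "s + 2 * L - 2 < q * L + L"
    using div_mult_mod_eq[of "s + 2 * L - 2" L] mod_less_divisor[OF L(2), of "s + 2 * L - 2"]
    unfolding q_def by linarith+
  moreover define r where "r = q * L - s"
  ultimately have r: "s + r = q * L" "L \<le> Suc r" "Suc r < 2 * L"
    using L(2) by auto
  then obtain w where w: "length w = m" "str_code w = r"
    using ex_str_code[of m r] unfolding L_def by metis
  have "read_bits m r (str_code (map (X \<circ> source) [s..<s'])) = str_code (map X [0..<g (m - m0)])"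
  proof (rule read_bits_eq, fold i_def)
    fix j assume j: "j < g i"
    then have "pos i j < L"
      using pos_less[of j 1 i] g_less_free[of i] L by simp
    \<comment> \<open>The block ends before offset \<open>3 * L\<close>, well inside the
      window.\<close>
    then have len: "r + pos i j < s' - s" using r(3) assms(2) unfolding L_def[symmetric] by linarith
    have "s + (r + pos i j) = pos i (q * free i + j)"
      unfolding pos_shift L r(1)[symmetric] by simp
    then show "r + pos i j < length (map (X \<circ> source) [s..<s'])
        \<and> map (X \<circ> source) [s..<s'] ! (r + pos i j) = X j"
      using len source_pos[OF j, of q] by (simp del: upt_Suc)
  qed
  then show ?thesis using that w by blast
qed

end

section \<open>Shift complexity from complexity\<close>

text \<open>Precision 1, at \<open>k = 0\<close>, suffices. If the sign is negative,
  \<open>f n\<close> and the absolute value of the approximation are both at most 1, so adding 2 to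
  the integer part works for either sign.\<close>

lemma computable_upper_approximation:
  assumes "computable_real_function f" "\<And>n. 0 \<le> f n"
  obtains F where "rec1 F" "\<And>n. f n \<le> real (F n)" "\<And>n. real (F n) \<le> f n + 3"
proof -
  obtain s p q where spq: "total_recursive2 p" "total_recursive2 q" "\<And>n k. q n k \<noteq> 0"
    "\<And>n k. \<bar>f n - (- 1) ^ s n k * real (p n k) / real (q n k)\<bar> \<le> 1 / 2 ^ k"
    using assms(1) unfolding computable_real_function_def by metis
  define F where "F n = p n 0 div q n 0 + 2" for n
  have "rec1 F"
    unfolding F_def
    by (intro total_rec_app2[OF total_recursive2_rec2[OF spq(1)]]
        total_rec_app2[OF total_recursive2_rec2[OF spq(2)]] total_rec_intros) simp_all
  moreover have "f n \<le> real (F n) \<and> real (F n) \<le> f n + 3" for n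
  proof -
    define x where "x = real (p n 0) / real (q n 0)"
    have "\<lfloor>x\<rfloor> = int (p n 0 div q n 0)" unfolding x_def by (rule floor_divide_of_nat_eq)
    then have F: "real (F n) \<le> x + 2" "x + 1 \<le> real (F n)"
      using of_int_floor_le[of x] real_of_int_floor_add_one_ge[of x] by (simp_all add: F_def)
    have "\<bar>f n - (- 1) ^ s n 0 * x\<bar> \<le> 1" "0 \<le> x"
      using spq(4)[of n 0] by (simp_all add: x_def)
    then show ?thesis
      using F assms(2)[of n] by (cases "even (s n 0)") (simp_all, linarith+)
  qed
  ultimately show ?thesis using that by blast
qed

text \<open>Each output value takes a single oracle query, at \<open>h n\<close>.\<close>

lemma strongly_reducible_if_recursive_substitution:
  assumes "rec1 h" and "\<And>X. X \<in> Q \<Longrightarrow> X \<circ> h \<in> P"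
  shows "in_baire P \<le>\<^sub>s in_baire Q"
proof -
  obtain p where "\<forall>A xs. length xs = 1 \<longrightarrow> run p A xs = Some (h (xs ! 0))"
    using assms(1) unfolding total_rec_def by blast
  then have p: "run p A [n] = Some (h n)" for A n by simp
  define \<Psi> where "\<Psi> = functional_of (Comp Oracle [p])"
  have "\<Psi> A = Some (\<lambda>n. A (h n))" for A
    by (simp add: \<Psi>_def functional_of_def p)
  then have "\<exists>Y\<in>in_baire P. \<Psi> A = Some Y" if "A \<in> in_baire Q" for A
    using that assms(2) unfolding in_baire_def by (fastforce simp: comp_def)
  then show ?thesis
    unfolding strongly_reducible_def partial_recursive_functional_def \<Psi>_def by blast
qed

text \<open>The shift by 3 costs a factor 8, and \<open>4 + 2 * m = 2 * (m + 1) + 2\<close> reduces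
  the rest to the geometric series and its derivative.\<close>

lemma summable_levels:
  fixes f :: "nat \<Rightarrow> real"
  assumes "summable (\<lambda>m. f (2 ^ m) / 2 ^ m)"
  shows "summable (\<lambda>m. C * (f (2 ^ (m + 3)) + 4 + 2 * real m) / 2 ^ m)"
proof -
  have "summable (\<lambda>m. f (2 ^ (m + 3)) / 2 ^ (m + 3))"
    using assms by (rule summable_ignore_initial_segment)
  moreover have "summable (\<lambda>m. real (Suc m) * (1 / 2) ^ m)"
    using geometric_deriv_sums[of "1 / 2 :: real"] by (auto intro: sums_summable)
  moreover have "summable (\<lambda>m. (1 / 2 :: real) ^ m)"
    by (rule summable_geometric) simp
  ultimately have "summable (\<lambda>m. 8 * C * (f (2 ^ (m + 3)) / 2 ^ (m + 3))
      + (2 * C * (real (Suc m) * (1 / 2) ^ m) + 2 * C * (1 / 2) ^ m))"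
    by (intro summable_add summable_mult)
  then show ?thesis
    by (rule summable_cong[THEN iffD1, rotated]) (simp add: field_simps power_add)
qed

theorem mainTheorem14:
  fixes U :: "bool list \<Rightarrow> bool list option"
    and f :: "nat \<Rightarrow> real"
    and \<delta> :: real
  assumes "universal_machine U"
    and "order_function f"
    and "sub_identical f"
    and "summable (\<lambda>m. f (2 ^ m) / 2 ^ m)"
    and "\<delta> \<in> \<rat>" and "0 < \<delta>" and "\<delta> \<le> 1"
  shows "in_baire (SC U f) \<le>\<^sub>s in_baire (COMPLEX U \<delta>)"
proof -
  have f: "computable_real_function f" "mono f" "\<And>n. 0 \<le> f n"
    using assms(2,3) unfolding order_function_def sub_identical_def by auto
  obtain F where F: "rec1 F" "\<And>n. f n \<le> real (F n)" "\<And>n. real (F n) \<le> f n + 3"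
    using computable_upper_approximation[OF f(1,3)] by blast
  \<comment> \<open>An integer \<open>C\<close> above \<open>1 / \<delta>\<close> keeps
    \<open>g\<close> recursive and makes up for the factor \<open>\<delta>\<close> in the complexity
    bound.\<close>
  obtain C :: nat where "1 / \<delta> < real C" using reals_Archimedean2 by blast
  then have C: "1 \<le> \<delta> * real C" "0 < C" using \<open>0 < \<delta>\<close> by (auto simp: field_simps intro: gr0I)
  \<comment> \<open>\<open>a m\<close> will bound the density of the positions given to blocks of
    length \<open>2 ^ m\<close>. The 4 consists of the error 3 of \<open>F\<close> and the summand 1
    that keeps \<open>g\<close> positive.\<close>
  define a where "a m = real C * (f (2 ^ (m + 3)) + 4 + 2 * real m) / 2 ^ m" for m
  have a_nonneg: "0 \<le> a m" for m using f(3) by (simp add: a_def)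
  have a_summable: "summable a" unfolding a_def by (rule summable_levels[OF assms(4)])
  then obtain m0 where "\<bar>\<Sum>i. a (i + m0)\<bar> < 1"
    using suminf_exist_split[of 1 a] by auto
  then have tail: "sum (\<lambda>i. a (i + m0)) I < 1" if "finite I" for I
    using sum_le_suminf[OF summable_ignore_initial_segment[OF a_summable, of m0] that] a_nonneg
    by fastforce

  text \<open>The summand \<open>2m\<close> pays for the description of the position of a block in a window.\<close>
  define g where "g i = C * (F (2 ^ (m0 + i + 3)) + 2 * (m0 + i) + 1)" for i
  interpret toeplitz_space g m0
  proof
    show "rec1 g"
      unfolding g_def by (intro total_rec_app1[OF F(1)] total_rec_intros) simp_all
    show "0 < g i" for i using C by (simp add: g_def)
    show "(\<Sum>j\<le>i. real (g j) / 2 ^ j) < 2 ^ m0" for i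
    proof -
      have "real (g j) / 2 ^ j \<le> 2 ^ m0 * a (j + m0)" for j
      proof -
        have "real (g j) \<le> real C * (f (2 ^ (j + m0 + 3)) + 4 + 2 * real (j + m0))"
          unfolding g_def of_nat_mult using F(3)[of "2 ^ (j + m0 + 3)"]
          by (intro mult_left_mono) (simp_all add: add.commute)
        then have "real (g j) / 2 ^ j
            \<le> real C * (f (2 ^ (j + m0 + 3)) + 4 + 2 * real (j + m0)) / 2 ^ j"
          by (rule divide_right_mono) simp
        then show ?thesis by (simp add: a_def power_add)
      qed
      then have "(\<Sum>j\<le>i. real (g j) / 2 ^ j) \<le> 2 ^ m0 * (\<Sum>j\<le>i. a (j + m0))"
        unfolding sum_distrib_left by (intro sum_mono)
      also have "\<dots> < 2 ^ m0" using tail[of "{..i}"] by simp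
      finally show ?thesis .
    qed
  qed
  obtain c where c: "\<And>w \<tau> \<tau>'. read_bits (length w) (str_code w) (str_code \<tau>) = str_code \<tau>' \<Longrightarrow>
      K U \<tau>' \<le> K U \<tau> + 2 * length w + c"
    using K_decode[OF assms(1) rec3_read_bits] by blast
  show ?thesis
  proof (rule strongly_reducible_if_recursive_substitution[OF rec1_source])
    fix X assume "X \<in> COMPLEX U \<delta>"
    then obtain d where d: "\<And>n. \<delta> * real n - real d \<le> real (K U (map X [0..<n]))"
      unfolding COMPLEX_def by auto
    \<comment> \<open>Substrings shorter than \<open>4 * 2 ^ m0\<close> are too short for
      \<open>ex_read_bits\<close>; there \<open>b\<close> bounds \<open>f\<close> by
      monotonicity.\<close>
    obtain b :: nat where b: "f (2 ^ (m0 + 2)) \<le> real b" using real_arch_simple by blast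
    have "f (length \<tau>) - real (b + c + d) \<le> real (K U \<tau>)"
      if "substring_of \<tau> (X \<circ> source)" for \<tau>
    proof (cases "length \<tau> < 2 ^ (m0 + 2)")
      case True
      then have "f (length \<tau>) \<le> f (2 ^ (m0 + 2))" by (intro monoD[OF f(2)]) simp
      then show ?thesis using b by simp
    next
      case False
      obtain s s' where \<tau>: "\<tau> = map (X \<circ> source) [s..<s']"
        using \<open>substring_of \<tau> (X \<circ> source)\<close> unfolding substring_of_def by blast
      obtain k where k: "2 ^ k \<le> length \<tau>" "length \<tau> < 2 ^ Suc k"
        using ex_power_ivl1[of 2 "length \<tau>"] False by (cases \<tau>) auto
      have "m0 + 2 < Suc k"
        using k(2) False power_strict_increasing_iff[of "2::nat" "m0 + 2" "Suc k"] by linarith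
      \<comment> \<open>Two less than \<open>k\<close>, as \<open>ex_read_bits\<close> asks for a
        window of four block lengths; the upper bound \<open>2 ^ (m + 3)\<close> is the argument of
        \<open>F\<close> in \<open>g (m - m0)\<close>.\<close>
      define m where "m = k - 2"
      have m: "m0 \<le> m" "4 * 2 ^ m \<le> length \<tau>" "length \<tau> < 2 ^ (m + 3)"
      proof -
        have "k = m + 2" using \<open>m0 + 2 < Suc k\<close> by (simp add: m_def)
        then show "m0 \<le> m" "4 * 2 ^ m \<le> length \<tau>" "length \<tau> < 2 ^ (m + 3)"
          using k \<open>m0 + 2 < Suc k\<close> by (simp_all add: power_add eval_nat_numeral)
      qed
      have "4 * 2 ^ m \<le> s' - s" using m(2) \<tau> by simp
      then obtain w where w: "length w = m"
        "read_bits m (str_code w) (str_code \<tau>) = str_code (map X [0..<g (m - m0)])"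
        using ex_read_bits[OF m(1)] unfolding \<tau> by blast
      have g: "g (m - m0) = C * (F (2 ^ (m + 3)) + 2 * m + 1)"
        using m(1) by (simp add: g_def)
      have "f (length \<tau>) \<le> f (2 ^ (m + 3))"
        using m(3) by (intro monoD[OF f(2)]) simp
      then have "f (length \<tau>) + 2 * real m \<le> real (F (2 ^ (m + 3)) + 2 * m + 1)"
        using F(2)[of "2 ^ (m + 3)"] by simp
      also have "\<dots> \<le> (\<delta> * real C) * real (F (2 ^ (m + 3)) + 2 * m + 1)"
        using mult_right_mono[OF C(1), of "real (F (2 ^ (m + 3)) + 2 * m + 1)"] by simp
      also have "\<dots> = \<delta> * real (g (m - m0))" unfolding g of_nat_mult by simp
      also have "\<dots> \<le> real (K U (map X [0..<g (m - m0)])) + real d"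
        using d[of "g (m - m0)"] by simp
      also have "\<dots> \<le> real (K U \<tau> + 2 * m + c) + real d"
        using c[of w \<tau> "map X [0..<g (m - m0)]"] w by simp
      finally show ?thesis by simp
    qed
    then show "X \<circ> source \<in> SC U f" unfolding SC_def by blast
  qed
qed

end
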